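(* Let $p$ be an odd prime, let $s,h,t,r$ be positive integers with $t\mid h$ and $s\le h$, and let $q=p^h$. Assume that $\mathbb{F}_q$ is the splitting field of $g(x)=x^{2rp^s}+ax^{2rp^s-1}+bx^{2rp^s-2}+c\in\mathbb{F}_{p^t}[x]$ with $a,b,c\neq0$ and $b\ne\frac12a^2$, and that $\alpha_1,\dots,\alpha_{2rp^s}$ are all the roots of $g(x)$ and are pairwise distinct. Let $v_i\in\mathbb{F}_{q^2}$ be such that $v_i^2=(g'(\alpha_i))^{-1}$ for $1\le i\le2rp^s$ (such $v_i$ exist). Let $\boldsymbol{\alpha}=(\alpha_1,\dots,\alpha_{2rp^s})$ and $\boldsymbol{v}=(v_1,\dots,v_{2rp^s})$. Let $\eta_1=2a^{-1}(a^2-2b)^{-1}$ and $\eta_2=-a\eta_1$. Set $$\mathcal{S}_1=\Big\{\sum_{i=0}^{rp^s-1}f_ix^i+2(a^2-2b)^{-1}\big(a^{-1}f_{rp^s-2}-f_{rp^s-1}\big)x^{rp^s+1}: f_i\in\mathbb{F}_{q^2}\text{ for }0\le i\le rp^s-1\Big\}.$$ Then $\mathcal{C}_1=ev_{\boldsymbol{\alpha},\boldsymbol{v}}(\mathcal{S}_1)$ is a $[2rp^s,\,rp^s,\,\ge rp^s-1]$ self-dual TGRS code over $\mathbb{F}_{q^2}$.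
   Context: For $\boldsymbol{\alpha}\in\mathbb{F}^n$ with distinct entries and $\boldsymbol{v}\in(\mathbb{F}^* )^n$ ($\mathbb{F}$ a finite field; here $\mathbb{F}=\mathbb{F}_{q^2}$), $ev_{\boldsymbol{\alpha},\boldsymbol{v}}(f)=(v_1f(\alpha_1),\dots,v_nf(\alpha_n))$ for $f\in\mathbb{F}[x]$. For a $k\times(n-k)$ matrix $(\eta_{ij})$ over $\mathbb{F}$, the twisted generalized Reed-Solomon (TGRS) code is the image under $ev_{\boldsymbol{\alpha},\boldsymbol{v}}$ of $\{\sum_{i=0}^{k-1}f_ix^i+\sum_{i=0}^{k-1}f_i\sum_{j=1}^{n-k}\eta_{i+1,j}x^{k-1+j}:f_i\in\mathbb{F}\}$. A linear code is $[n,k,\ge d]$ if it has length $n$, dimension $k$ and minimum Hamming distance at least $d$. It is self-dual if $\mathcal{C}=\mathcal{C}^\perp$ for the Euclidean inner product. *)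

theory Defs
  imports "HOL-Analysis.Analysis" "HOL-Computational_Algebra.Computational_Algebra"
begin

definition is_subfield :: "'a::field set \<Rightarrow> bool" where
  "is_subfield K \<longleftrightarrow> 0 \<in> K \<and> 1 \<in> K \<and>
     (\<forall>x\<in>K. \<forall>y\<in>K. x - y \<in> K \<and> x * y \<in> K) \<and> (\<forall>x\<in>K. inverse x \<in> K)"

definition is_splitting_field :: "'a::field set \<Rightarrow> 'a set \<Rightarrow> 'a poly \<Rightarrow> bool" where
  "is_splitting_field K L g \<longleftrightarrow>
     is_subfield K \<and> is_subfield L \<and> K \<subseteq> L \<and> (\<forall>i. coeff g i \<in> K) \<and>
     (\<exists>A. set_mset A \<subseteq> L \<and> g = smult (lead_coeff g) (\<Prod>x\<in>#A. [:- x, 1:])) \<and>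
     (\<forall>M. is_subfield M \<and> K \<subseteq> M \<and> {x \<in> L. poly g x = 0} \<subseteq> M \<longrightarrow> L \<subseteq> M)"

text \<open>A word of length \<open>n\<close> is an element of \<open>'a ^ 'n\<close> with \<open>CARD('n) = n\<close>. Subspaces and
  dimension over an arbitrary field are \<open>vec.subspace\<close> and \<open>vec.dim\<close>; the unqualified
  \<open>subspace\<close>, \<open>dim\<close> and the operator \<open>inner\<close> are for real vector spaces.\<close>

definition hamming_dist :: "'a ^ 'n \<Rightarrow> 'a ^ 'n \<Rightarrow> nat" where
  "hamming_dist x y = card {i. x $ i \<noteq> y $ i}"

text \<open>The infimum is only meaningful (and attained) for codes with at least two words;
  otherwise it is \<open>Inf {} = 0\<close>.\<close>

definition min_distance :: "('a ^ 'n) set \<Rightarrow> nat" where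
  "min_distance C = Inf {hamming_dist x y |x y. x \<in> C \<and> y \<in> C \<and> x \<noteq> y}"

text \<open>\<open>C\<close> is an \<open>[n, k, \<ge> d]\<close> linear code.\<close>

definition is_linear_code :: "nat \<Rightarrow> nat \<Rightarrow> nat \<Rightarrow> ('a::field ^ 'n) set \<Rightarrow> bool" where
  "is_linear_code n k d C \<longleftrightarrow>
     CARD('n) = n \<and> vec.subspace C \<and> vec.dim C = k \<and> min_distance C \<ge> d"

definition dual_code :: "('a::field ^ 'n) set \<Rightarrow> ('a ^ 'n) set" where
  "dual_code C = {y. \<forall>x\<in>C. (\<Sum>i\<in>UNIV. x $ i * y $ i) = 0}"

definition self_dual :: "('a::field ^ 'n) set \<Rightarrow> bool" where
  "self_dual C \<longleftrightarrow> C = dual_code C"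

definition ev :: "'a::field ^ 'n \<Rightarrow> 'a ^ 'n \<Rightarrow> 'a poly \<Rightarrow> 'a ^ 'n" where
  "ev \<alpha> v f = (\<chi> i. v $ i * poly f (\<alpha> $ i))"

text \<open>The twist matrix is indexed from 1: only the entries \<open>\<eta> i j\<close> with \<open>1 \<le> i \<le> k\<close> and
  \<open>1 \<le> j \<le> n - k\<close> are used.\<close>

definition tgrs_polys :: "nat \<Rightarrow> nat \<Rightarrow> (nat \<Rightarrow> nat \<Rightarrow> 'a::field) \<Rightarrow> 'a poly set" where
  "tgrs_polys n k \<eta> =
     {(\<Sum>i<k. monom (f i) i)
        + (\<Sum>i<k. smult (f i) (\<Sum>j=1..n - k. monom (\<eta> (i + 1) j) (k - 1 + j))) |f. True}"

definition tgrs_code ::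
    "nat \<Rightarrow> (nat \<Rightarrow> nat \<Rightarrow> 'a::field) \<Rightarrow> 'a ^ 'n \<Rightarrow> 'a ^ 'n \<Rightarrow> ('a ^ 'n) set" where
  "tgrs_code k \<eta> \<alpha> v = ev \<alpha> v ` tgrs_polys CARD('n) k \<eta>"

definition is_TGRS :: "nat \<Rightarrow> ('a::field ^ 'n) set \<Rightarrow> bool" where
  "is_TGRS k C \<longleftrightarrow> k \<le> CARD('n) \<and>
     (\<exists>\<eta> \<alpha> v. inj (($) \<alpha>) \<and> (\<forall>i. v $ i \<noteq> 0) \<and> C = tgrs_code k \<eta> \<alpha> v)"

end

theory Submission
  imports Defs
begin

text \<open>
  Since the roots \<open>x\<close> of \<open>g\<close> are simple, Lagrange interpolation shows that
  \<open>E f = (\<Sum>x. f x / g' x)\<close> is the coefficient of \<open>f\<close> at \<open>n - 1\<close> whenever \<open>deg f < n = 2 * k\<close>;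
  reducing modulo \<open>g\<close> gives a formula in terms of \<open>a\<close> and \<open>b\<close> for \<open>deg f \<le> n + 2\<close>.
  Because \<open>v i ^ 2 = 1 / g' (\<alpha> i)\<close>, the inner product of the words of \<open>P\<close> and \<open>Q\<close> is \<open>E (P * Q)\<close>,
  and for twisted \<open>P\<close> and \<open>Q\<close> the formula evaluates to 0. Conversely, a word orthogonal to the
  code is interpolated by a polynomial of degree less than \<open>n\<close>; testing it against the monomials
  \<open>x ^ i\<close> with \<open>i < k - 2\<close> bounds its degree by \<open>k + 1\<close>, and two further test polynomials force
  the twist relation.

  The scaling vector exists since \<open>g'\<close> takes nonzero values in the subfield with \<open>q\<close> elements at
  the roots, and every element of that subfield is a square in the field with \<open>q ^ 2\<close> elements.
\<close>

subsection \<open>Sums over the roots of a polynomial\<close>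

text \<open>Both sides are monic of degree \<open>card A\<close> and vanish on \<open>A\<close>, so
  their difference has more roots than its degree allows unless it is 0. Positive degree makes
  \<open>card A\<close> positive and hence \<open>A\<close> finite.\<close>

lemma monic_poly_eq_prod_roots:
  fixes g :: "'a::field poly"
  assumes "lead_coeff g = 1" "card A = degree g" "degree g > 0" "\<And>x. x \<in> A \<Longrightarrow> poly g x = 0"
  shows "g = (\<Prod>x\<in>A. [:- x, 1:])"
proof -
  have fin: "finite A"
    using assms(2,3) card_gt_0_iff by metis
  have deg: "degree (\<Prod>x\<in>A. [:- x, 1:]) = card A"
    by (subst degree_prod_eq_sum_degree) (auto simp: one_pCons)
  show ?thesis
  proof (rule poly_eqI_degree_lead_coeff[where A = A and n = "card A"])
    show "coeff g (card A) = coeff (\<Prod>x\<in>A. [:- x, 1:]) (card A)"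
      using assms(1,2) deg lead_coeff_prod[of "\<lambda>x. [:- x, 1:]" A] by simp
  qed (use assms fin deg in \<open>auto simp: poly_prod\<close>)
qed

text \<open>In the product rule every term that keeps the factor belonging to \<open>x\<close>
  vanishes at \<open>x\<close>; a single term survives.\<close>

lemma poly_pderiv_prod_linear:
  fixes A :: "'a::field set"
  assumes "finite A" "x \<in> A"
  shows "poly (pderiv (\<Prod>y\<in>A. [:- y, 1:])) x = (\<Prod>y\<in>A - {x}. x - y)"
proof -
  have "poly (pderiv (\<Prod>y\<in>A. [:- y, 1:])) x
      = (\<Sum>z\<in>A. \<Prod>y\<in>A - {z}. x - y)"
    by (simp add: pderiv_prod poly_sum poly_prod pderiv_pCons)
  also have "\<dots> = (\<Sum>z\<in>A. if z = x then \<Prod>y\<in>A - {x}. x - y else 0)"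
    using assms by (intro sum.cong) (auto intro!: prod_zero)
  finally show ?thesis
    using assms by simp
qed

lemma poly_pderiv_prod_linear_nonzero:
  fixes A :: "'a::field set"
  assumes "finite A" "x \<in> A"
  shows "poly (pderiv (\<Prod>y\<in>A. [:- y, 1:])) x \<noteq> 0"
  using assms by (simp add: poly_pderiv_prod_linear)

text \<open>Left unnormalised: for g the product of all linear factors over \<open>A\<close>, its
  value at \<open>x\<close> is g'(x) instead of 1. It is monic this way, and the division by g'(x)
  moves into the scalars of the interpolation sum.\<close>

definition lagrange_basis :: "'a::field set \<Rightarrow> 'a \<Rightarrow> 'a poly" where
  "lagrange_basis A x = (\<Prod>y\<in>A - {x}. [:- y, 1:])"

lemma degree_lagrange_basis:
  assumes "finite A" "x \<in> A"
  shows "degree (lagrange_basis A x) = card A - 1"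
  using assms unfolding lagrange_basis_def
  by (subst degree_prod_eq_sum_degree) (auto simp: one_pCons)

lemma coeff_lagrange_basis:
  assumes "finite A" "x \<in> A"
  shows "coeff (lagrange_basis A x) (card A - 1) = 1"
  using degree_lagrange_basis[OF assms] lead_coeff_prod[of "\<lambda>x. [:- x, 1:]" "A - {x}"]
  by (simp add: lagrange_basis_def)

lemma degree_lagrange_sum_less:
  assumes "finite A" "A \<noteq> {}"
  shows "degree (\<Sum>x\<in>A. smult (u x) (lagrange_basis A x)) < card A"
proof -
  have "degree (\<Sum>x\<in>A. smult (u x) (lagrange_basis A x)) \<le> card A - 1"
    using assms by (intro degree_sum_le) (auto intro!: order_trans[OF degree_smult_le]
      simp: degree_lagrange_basis)
  moreover have "card A > 0"
    using assms by (simp add: card_gt_0_iff)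
  ultimately show ?thesis
    by linarith
qed

lemma poly_lagrange_sum:
  assumes "finite A" "z \<in> A"
  shows "poly (\<Sum>x\<in>A. smult (u x) (lagrange_basis A x)) z
       = u z * poly (pderiv (\<Prod>y\<in>A. [:- y, 1:])) z"
proof -
  have "poly (\<Sum>x\<in>A. smult (u x) (lagrange_basis A x)) z
      = (\<Sum>x\<in>A. if x = z then u z * (\<Prod>y\<in>A - {z}. z - y) else 0)"
    unfolding poly_sum using assms
    by (intro sum.cong) (auto simp: lagrange_basis_def poly_prod intro!: prod_zero)
  thus ?thesis
    using assms by (simp add: poly_pderiv_prod_linear)
qed

lemma exists_interpolating_poly:
  fixes A :: "'a::field set"
  assumes "finite A" "A \<noteq> {}"
  obtains P where "degree P < card A" "\<And>x. x \<in> A \<Longrightarrow> poly P x = w x"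
proof
  let ?u = "\<lambda>x. w x / poly (pderiv (\<Prod>y\<in>A. [:- y, 1:])) x"
  show "degree (\<Sum>x\<in>A. smult (?u x) (lagrange_basis A x)) < card A"
    using assms by (rule degree_lagrange_sum_less)
  show "poly (\<Sum>x\<in>A. smult (?u x) (lagrange_basis A x)) x = w x" if "x \<in> A" for x
    using assms that poly_pderiv_prod_linear_nonzero[OF assms(1) that]
    by (simp add: poly_lagrange_sum)
qed

text \<open>\<open>f\<close> equals its own Lagrange interpolant, and each basis polynomial has
  coefficient 1 at \<open>card A - 1\<close>.\<close>

lemma sum_div_pderiv_eq_coeff:
  fixes A :: "'a::field set"
  assumes "finite A" "degree f < card A"
  shows "(\<Sum>x\<in>A. poly f x / poly (pderiv (\<Prod>y\<in>A. [:- y, 1:])) x) = coeff f (card A - 1)"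
proof -
  let ?u = "\<lambda>x. poly f x / poly (pderiv (\<Prod>y\<in>A. [:- y, 1:])) x"
  let ?P = "\<Sum>x\<in>A. smult (?u x) (lagrange_basis A x)"
  have ne: "A \<noteq> {}"
    using assms by auto
  have "f = ?P"
  proof (rule poly_eqI_degree[of A])
    show "poly f x = poly ?P x" if "x \<in> A" for x
      using assms that poly_pderiv_prod_linear_nonzero[OF assms(1) that]
      by (simp add: poly_lagrange_sum)
    show "degree ?P < card A"
      using assms(1) ne by (rule degree_lagrange_sum_less)
  qed (use assms in auto)
  hence "coeff f (card A - 1) = coeff ?P (card A - 1)"
    by (rule arg_cong)
  thus ?thesis
    using assms coeff_lagrange_basis[OF assms(1)] by (simp add: coeff_sum)
qed

text \<open>\<open>u2 x\<^sup>2 + u1 x + u0\<close> is the quotient and \<open>r\<close> the remainder of \<open>f\<close> modulo \<open>g\<close>; the bound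
  \<open>n \<ge> 4\<close> keeps the constant term of \<open>g\<close> out of the way.\<close>

lemma sum_div_pderiv_quadrinomial:
  fixes A :: "'a::field set" and a b c :: 'a
  assumes g: "g = (\<Prod>x\<in>A. [:- x, 1:])"
    and g': "g = monom 1 n + monom a (n - 1) + monom b (n - 2) + [:c:]"
    and A: "card A = n" "n \<ge> 4" and deg: "degree f \<le> n + 2"
  shows "(\<Sum>x\<in>A. poly f x / poly (pderiv g) x) =
    coeff f (n - 1) - a * coeff f n + (a\<^sup>2 - b) * coeff f (n + 1)
      + (2 * a * b - a ^ 3) * coeff f (n + 2)"
proof -
  define u2 where "u2 = coeff f (n + 2)"
  define u1 where "u1 = coeff f (n + 1) - a * u2"
  define u0 where "u0 = coeff f n - a * u1 - b * u2"
  define r where "r = f - (monom u2 2 * g + monom u1 1 * g + monom u0 0 * g)"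
  have fin: "finite A"
    using A card.infinite by fastforce
  \<comment> \<open>This removes truncated subtraction from the coefficient indices.\<close>
  obtain l where l: "n = l + 4"
    using A(2) by (metis le_add_diff_inverse2)
  have cg: "coeff g (l + 4) = 1" "coeff g (l + 3) = a" "coeff g (l + 2) = b"
    "coeff g (l + 1) = 0" and cg0: "m > l + 4 \<Longrightarrow> coeff g m = 0" for m
    by (auto simp: g' l coeff_pCons split: nat.splits)
  have r: "coeff r (m + 2) =
      coeff f (m + 2) - (u2 * coeff g m + u1 * coeff g (m + 1) + u0 * coeff g (m + 2))" for m
    by (simp add: r_def coeff_monom_mult)
  \<comment> \<open>The scalars \<open>u0\<close>, \<open>u1\<close>, \<open>u2\<close> are chosen
    to cancel the coefficients at \<open>n\<close>, \<open>n + 1\<close>, \<open>n + 2\<close>;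
    above that, neither \<open>f\<close> nor the multiples of \<open>g\<close> have any.\<close>
  have "coeff r m = 0" if "m \<ge> n" for m
  proof -
    define m' where "m' = m - 2"
    have m': "m = m' + 2"
      using that l by (simp add: m'_def)
    consider "m' = l + 2" | "m' = l + 3" | "m' = l + 4" | "m' > l + 4"
      using \<open>m \<ge> n\<close> l m' by linarith
    thus ?thesis
    proof cases
      case 1
      thus ?thesis
        using r[of "l + 2"] cg by (simp add: m' l u0_def algebra_simps numeral_eq_Suc)
    next
      case 2
      thus ?thesis
        using r[of "l + 3"] cg cg0[of "l + 5"] by (simp add: m' l u1_def algebra_simps numeral_eq_Suc)
    next
      case 3
      thus ?thesis
        using r[of "l + 4"] cg cg0[of "l + 5"] cg0[of "l + 6"]
        by (simp add: m' l u2_def algebra_simps numeral_eq_Suc)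
    next
      case 4
      thus ?thesis
        using deg r[of m'] cg0 by (simp add: m' l coeff_eq_0)
    qed
  qed
  hence "degree r < card A"
    using A by (intro degree_lessI) auto
  hence "(\<Sum>x\<in>A. poly r x / poly (pderiv g) x) = coeff r (n - 1)"
    using sum_div_pderiv_eq_coeff[OF fin] A g by simp
  moreover have "poly r x = poly f x" if "x \<in> A" for x
  proof -
    have "poly g x = 0"
      using that fin by (auto simp: g poly_prod)
    thus ?thesis
      by (simp add: r_def)
  qed
  \<comment> \<open>\<open>u2\<close> is absent because it would multiply the coefficient of
    \<open>g\<close> at \<open>n - 3\<close>, which is 0.\<close>
  moreover have "coeff r (n - 1) = coeff f (n - 1) - u1 * b - u0 * a"
    using r[of "l + 1"] cg by (simp add: l numeral_eq_Suc)
  ultimately show ?thesis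
    by (simp add: u0_def u1_def u2_def algebra_simps power2_eq_square power3_eq_cube)
qed

text \<open>Outside this range one of the two indices exceeds \<open>d\<close>. For \<open>m\<close>
  close to \<open>2 * d\<close> the convolution shrinks to a few explicit terms.\<close>

lemma coeff_mult_bounded:
  fixes P Q :: "'a::comm_semiring_0 poly"
  assumes "degree P \<le> d" "degree Q \<le> d"
  shows "coeff (P * Q) m = (\<Sum>i=m - d..min d m. coeff P i * coeff Q (m - i))"
  unfolding coeff_mult using assms
  by (intro sum.mono_neutral_right) (force simp: coeff_eq_0)+

text \<open>The product has degree at most \<open>2 * k + 2\<close>, exactly the reach of the
  quadrinomial formula for \<open>n = 2 * k\<close>. \<open>coeff P k\<close> stays free so that the
  formula also covers a \<open>P\<close> not yet known to be twisted.\<close>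

lemma sum_div_pderiv_mult:
  fixes A :: "'a::field set" and a b c :: 'a
  assumes "g = (\<Prod>x\<in>A. [:- x, 1:])"
    and "g = monom 1 (2 * k) + monom a (2 * k - 1) + monom b (2 * k - 2) + [:c:]"
    and "card A = 2 * k" "k \<ge> 2" "degree P \<le> k + 1" "degree Q \<le> k + 1" "coeff Q k = 0"
  shows "(\<Sum>x\<in>A. poly (P * Q) x / poly (pderiv g) x) =
    coeff P k * (coeff Q (k - 1) + (a\<^sup>2 - b) * coeff Q (k + 1))
      + coeff P (k + 1) * (coeff Q (k - 2) - a * coeff Q (k - 1))
      + coeff Q (k + 1) * (coeff P (k - 2) - a * coeff P (k - 1))
      - a * (a\<^sup>2 - 2 * b) * coeff P (k + 1) * coeff Q (k + 1)"
proof -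
  obtain l where l: "k = l + 2"
    using assms(4) by (metis le_add_diff_inverse2)
  have c: "coeff (P * Q) m = (\<Sum>i=m - (l+3)..min (l+3) m. coeff P i * coeff Q (m - i))" for m
    using coeff_mult_bounded[of P "l + 3" Q m] assms(5,6) l by simp
  have "coeff (P * Q) (2 * l + 3) = (\<Sum>i=l..l+3. coeff P i * coeff Q (2 * l + 3 - i))"
    "coeff (P * Q) (2 * l + 4) = (\<Sum>i=l+1..l+3. coeff P i * coeff Q (2 * l + 4 - i))"
    "coeff (P * Q) (2 * l + 5) = (\<Sum>i=l+2..l+3. coeff P i * coeff Q (2 * l + 5 - i))"
    "coeff (P * Q) (2 * l + 6) = (\<Sum>i=l+3..l+3. coeff P i * coeff Q (2 * l + 6 - i))"
    unfolding c by (intro sum.cong; simp)+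
  moreover have k: "2 * k - 1 = 2 * l + 3" "2 * k = 2 * l + 4" "2 * k + 1 = 2 * l + 5"
    "2 * k + 2 = 2 * l + 6"
    using l by auto
  ultimately have "coeff (P * Q) (2*k-1) = coeff P l * coeff Q (l+3) + coeff P (l+1) * coeff Q (l+2)
        + coeff P (l+2) * coeff Q (l+1) + coeff P (l+3) * coeff Q l"
    "coeff (P * Q) (2*k) = coeff P (l+1) * coeff Q (l+3) + coeff P (l+2) * coeff Q (l+2)
        + coeff P (l+3) * coeff Q (l+1)"
    "coeff (P * Q) (2*k+1) = coeff P (l+2) * coeff Q (l+3) + coeff P (l+3) * coeff Q (l+2)"
    "coeff (P * Q) (2*k+2) = coeff P (l+3) * coeff Q (l+3)"
    by (simp_all add: eval_nat_numeral)
  moreover have "degree (P * Q) \<le> 2 * k + 2"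
    using degree_mult_le[of P Q] assms(5,6) by linarith
  ultimately show ?thesis
    using assms(7) l
    by (subst sum_div_pderiv_quadrinomial[OF assms(1-3)])
      (simp_all add: algebra_simps power2_eq_square power3_eq_cube numeral_3_eq_3)
qed

subsection \<open>Square roots in a quadratic extension of finite fields\<close>

text \<open>Squaring is at most two-to-one, so there are at least \<open>N = (CARD('a) - 1) div 2\<close> nonzero squares,
  all of them among the at most \<open>N\<close> roots of \<open>x ^ N - 1\<close>.\<close>

lemma finite_field_exists_sqrt:
  fixes y :: "'a::finite_field"
  assumes "odd CARD('a)" "y ^ ((CARD('a) - 1) div 2) = 1"
  obtains x where "x\<^sup>2 = y"
proof -
  define N where "N = (CARD('a) - 1) div 2"
  define S where "S = (\<lambda>x::'a. x\<^sup>2) ` (- {0})"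
  define R where "R = {x::'a. poly (monom 1 N - 1) x = 0}"
  have card: "CARD('a) = 2 * N + 1"
    using assms(1) by (auto simp: N_def elim!: oddE)
  have "CARD('a) \<noteq> 1"
    by (metis card_1_singletonE UNIV_I singletonD zero_neq_one)
  hence N: "N > 0"
    using card by auto
  hence "coeff (monom 1 N - 1 :: 'a poly) 0 \<noteq> 0"
    by simp
  hence ne: "monom 1 N - 1 \<noteq> (0 :: 'a poly)"
    by (metis coeff_0)
  have "2 * N = card (- {0::'a})"
    using card by (simp add: Compl_eq_Diff_UNIV)
  also have "- {0::'a} = (\<Union>z\<in>S. {x. x \<noteq> 0 \<and> x\<^sup>2 = z})"
    by (auto simp: S_def)
  also have "card \<dots> \<le> (\<Sum>z\<in>S. card {x. x \<noteq> 0 \<and> x\<^sup>2 = z})"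
    by (rule card_UN_le) (simp add: S_def)
  also have "\<dots> \<le> (\<Sum>z\<in>S. 2)"
  proof (rule sum_mono)
    fix z assume "z \<in> S"
    then obtain u where "z = u\<^sup>2"
      by (auto simp: S_def)
    hence "{x. x \<noteq> 0 \<and> x\<^sup>2 = z} \<subseteq> {u, - u}"
      by (auto simp: power2_eq_iff)
    from card_mono[OF _ this] show "card {x. x \<noteq> 0 \<and> x\<^sup>2 = z} \<le> 2"
      using card_insert_le_m1[of 2 "{- u}" u] by simp
  qed
  finally have "N \<le> card S"
    by simp
  moreover have "card R \<le> N"
  proof -
    have "degree (monom 1 N - 1 :: 'a poly) \<le> N"
      by (rule degree_diff_le) (auto simp: degree_monom_le)
    thus ?thesis
      using card_poly_roots_bound[OF ne] by (simp add: R_def)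
  qed
  moreover have "S \<subseteq> R"
  proof -
    have "x ^ (2 * N) = 1" if "x \<noteq> 0" for x :: 'a
      using finite_field_power_card_eq_same[of x] that card by simp
    thus ?thesis
      by (auto simp: S_def R_def poly_monom simp flip: power_mult)
  qed
  ultimately have "S = R"
    using card_mono[of R S] by (intro card_subset_eq) auto
  moreover have "y \<in> R"
    using assms(2) by (simp add: R_def poly_monom N_def)
  ultimately show ?thesis
    using that by (auto simp: S_def)
qed

text \<open>Multiplication by \<open>y\<close> permutes the nonzero elements of \<open>K\<close>, so
  it leaves their product unchanged; cancelling that product gives the claim.\<close>

lemma subfield_power_card_minus_1:
  fixes K :: "'a::field set"
  assumes "is_subfield K" "finite K" "y \<in> K" "y \<noteq> 0"
  shows "y ^ (card K - 1) = 1"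
proof -
  have mult: "u * w \<in> K" and inv: "inverse u \<in> K" if "u \<in> K" "w \<in> K" for u w
    using assms(1) that by (auto simp: is_subfield_def)
  have "y ^ card (K - {0}) * \<Prod>(K - {0}) = (\<Prod>z\<in>K-{0}. y * z)"
    by (simp add: prod.distrib)
  also have "\<dots> = \<Prod>(K - {0})"
    by (rule prod.reindex_bij_witness[of _ "\<lambda>z. inverse y * z" "\<lambda>z. y * z"])
      (use assms(3,4) mult inv in auto)
  finally have "y ^ card (K - {0}) = 1"
    using assms(2) by simp
  moreover have "0 \<in> K"
    using assms(1) by (simp add: is_subfield_def)
  ultimately show ?thesis
    using assms(2) by simp
qed

text \<open>The exponent in Euler's criterion, half of \<open>card K ^ 2 - 1\<close>, is a multiple
  of \<open>card K - 1\<close> because \<open>card K + 1\<close> is even. So every nonzero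
  \<open>y\<close> in \<open>K\<close> passes the criterion.\<close>

lemma subfield_has_sqrt_in_quadratic_extension:
  fixes K :: "'a::finite_field set"
  assumes "is_subfield K" "odd (card K)" "CARD('a) = card K ^ 2" "y \<in> K"
  obtains x where "x\<^sup>2 = y"
proof (cases "y = 0")
  case True
  thus ?thesis
    using that[of 0] by simp
next
  case False
  obtain m where m: "card K = 2 * m + 1"
    using assms(2) by (elim oddE)
  have "(CARD('a) - 1) div 2 = (card K - 1) * (m + 1)"
    by (simp add: assms(3) m power2_eq_square)
  hence "y ^ ((CARD('a) - 1) div 2) = 1"
    using subfield_power_card_minus_1[OF assms(1) _ assms(4) False]
    by (simp add: power_mult del: mult_Suc_right add_Suc_right One_nat_def)
  thus ?thesis
    using finite_field_exists_sqrt[of y] assms(2,3) that by auto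
qed

section \<open>Closure properties of subfields and roots in a splitting field\<close>

lemma poly_in_subfield:
  assumes "is_subfield K" "\<And>i. coeff f i \<in> K" "x \<in> K"
  shows "poly f x \<in> K"
  using assms(2)
proof (induction f)
  case 0
  thus ?case
    using assms(1) by (simp add: is_subfield_def)
next
  case (pCons u f)
  have "u \<in> K"
    using pCons.prems[of 0] by simp
  moreover have "poly f x \<in> K"
    using pCons.prems[of "Suc _"] by (intro pCons.IH) simp
  moreover have "z + w \<in> K" if "z \<in> K" "w \<in> K" for z w
  proof -
    \<comment> \<open>Subfields are axiomatised by subtraction, so a sum is written as a double
      difference.\<close>
    have "z - (0 - w) \<in> K"
      using assms(1) that unfolding is_subfield_def by blast
    thus ?thesis
      by simp
  qed
  ultimately show ?case
    using assms(1,3) by (simp add: is_subfield_def)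
qed

lemma of_nat_in_subfield:
  assumes "is_subfield K"
  shows "of_nat m \<in> K"
proof (induction m)
  case 0
  thus ?case
    using assms by (simp add: is_subfield_def)
next
  case (Suc m)
  have "of_nat m - (0 - 1) \<in> K"
    using assms Suc unfolding is_subfield_def by blast
  thus ?case
    by (simp add: add.commute)
qed

lemma coeff_pderiv_in_subfield:
  assumes "is_subfield K" "\<And>i. coeff f i \<in> K"
  shows "coeff (pderiv f) i \<in> K"
  using assms of_nat_in_subfield[OF assms(1), of "Suc i"]
  unfolding coeff_pderiv is_subfield_def by blast

lemma splitting_field_contains_roots:
  assumes "is_splitting_field K L g" "g \<noteq> 0" "poly g x = 0"
  shows "x \<in> L"
proof -
  obtain B where B: "set_mset B \<subseteq> L" "g = smult (lead_coeff g) (\<Prod>x\<in>#B. [:- x, 1:])"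
    using assms(1) by (auto simp: is_splitting_field_def)
  have "poly (smult (lead_coeff g) (\<Prod>x\<in>#B. [:- x, 1:])) x = 0"
    using assms(3) B(2) by simp
  hence "x \<in># B"
    using assms(2) by (auto simp: poly_prod_mset prod_mset_zero_iff)
  thus ?thesis
    using B(1) by auto
qed

subsection \<open>Twisted polynomials and their evaluation codes\<close>

text \<open>A description by linear conditions on coefficients instead of a parametrisation: closure
  under linear combinations and membership of test polynomials are then read off directly.\<close>

definition twisted_polys :: "nat \<Rightarrow> 'a::field \<Rightarrow> 'a \<Rightarrow> 'a poly set" where
  "twisted_polys k \<eta>1 \<eta>2 = {P. degree P \<le> k + 1 \<and> coeff P k = 0 \<and>
     coeff P (k + 1) = \<eta>1 * coeff P (k - 2) + \<eta>2 * coeff P (k - 1)}"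

lemma twisted_polys_eq:
  assumes "k \<ge> 2"
  shows "twisted_polys k \<eta>1 \<eta>2 =
    {(\<Sum>i<k. monom (f i) i) + monom (\<eta>1 * f (k - 2) + \<eta>2 * f (k - 1)) (k + 1) |f. True}"
    (is "_ = ?S")
proof -
  have c: "coeff ((\<Sum>i<k. monom (f i) i) + monom w (k + 1)) m =
      (if m < k then f m else if m = k + 1 then w else 0)" for f :: "nat \<Rightarrow> 'a" and w m
    by (simp add: coeff_sum)
  show ?thesis
  proof (intro equalityI subsetI)
    fix P assume P: "P \<in> twisted_polys k \<eta>1 \<eta>2"
    have "P = (\<Sum>i<k. monom (coeff P i) i)
        + monom (\<eta>1 * coeff P (k - 2) + \<eta>2 * coeff P (k - 1)) (k + 1)"
    proof (rule poly_eqI, unfold c)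
      fix m
      show "coeff P m = (if m < k then coeff P m else if m = k + 1
          then \<eta>1 * coeff P (k - 2) + \<eta>2 * coeff P (k - 1) else 0)"
        using P by (cases "m = k") (auto simp: twisted_polys_def intro!: coeff_eq_0)
    qed
    thus "P \<in> ?S"
      by blast
  next
    fix P assume "P \<in> ?S"
    then obtain f where P: "P = (\<Sum>i<k. monom (f i) i)
        + monom (\<eta>1 * f (k - 2) + \<eta>2 * f (k - 1)) (k + 1)"
      by blast
    have "degree P \<le> k + 1"
      unfolding P by (rule degree_le) (simp only: c, auto)
    moreover have "coeff P k = 0" "coeff P (k - 2) = f (k - 2)" "coeff P (k - 1) = f (k - 1)"
      "coeff P (k + 1) = \<eta>1 * f (k - 2) + \<eta>2 * f (k - 1)"
      using assms unfolding P c by auto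
    ultimately show "P \<in> twisted_polys k \<eta>1 \<eta>2"
      by (simp add: twisted_polys_def)
  qed
qed

text \<open>Column 2 of the twist matrix belongs to the exponent \<open>k - 1 + 2 = k + 1\<close>.
  Rows count from 1, so rows \<open>k - 1\<close> and \<open>k\<close> carry the scalars for
  \<open>f (k - 2)\<close> and \<open>f (k - 1)\<close>.\<close>

lemma tgrs_polys_eq_twisted_polys:
  assumes "k \<ge> 2" "n = 2 * k"
  shows "tgrs_polys n k (\<lambda>i j. if i = k - 1 \<and> j = 2 then \<eta>1
           else if i = k \<and> j = 2 then \<eta>2 else 0) = twisted_polys k \<eta>1 \<eta>2"
proof -
  define \<eta> where "\<eta> = (\<lambda>i j. if i = k - 1 \<and> j = (2::nat) then \<eta>1
    else if i = k \<and> j = 2 then \<eta>2 else 0)"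
  have "(\<Sum>i<k. smult (f i) (\<Sum>j=1..n - k. monom (\<eta> (i + 1) j) (k - 1 + j)))
      = monom (\<eta>1 * f (k - 2) + \<eta>2 * f (k - 1)) (k + 1)" for f :: "nat \<Rightarrow> 'a"
  proof -
    have "(\<Sum>j=1..n - k. monom (\<eta> i j) (k - 1 + j)) = monom (\<eta> i 2) (k + 1)" for i
    proof -
      have "(\<Sum>j=1..n - k. monom (\<eta> i j) (k - 1 + j))
          = (\<Sum>j\<in>{2}. monom (\<eta> i j) (k - 1 + j))"
        using assms by (intro sum.mono_neutral_right) (auto simp: \<eta>_def)
      thus ?thesis
        using assms by (simp add: numeral_2_eq_2)
    qed
    hence "(\<Sum>i<k. smult (f i) (\<Sum>j=1..n - k. monom (\<eta> (i + 1) j) (k - 1 + j)))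
        = (\<Sum>i<k. monom (f i * \<eta> (i + 1) 2) (k + 1))"
      by (simp only: smult_monom)
    also have "\<dots> = (\<Sum>i\<in>{k - 2, k - 1}. monom (f i * \<eta> (i + 1) 2) (k + 1))"
      using assms by (intro sum.mono_neutral_right) (auto simp: \<eta>_def)
    also have "\<dots> = monom (\<eta>1 * f (k - 2) + \<eta>2 * f (k - 1)) (k + 1)"
      using assms by (auto simp: \<eta>_def add_monom mult.commute numeral_2_eq_2 Suc_diff_Suc)
    finally show ?thesis .
  qed
  thus ?thesis
    unfolding \<eta>_def[symmetric] unfolding tgrs_polys_def twisted_polys_eq[OF assms(1)]
    by (simp only:)
qed

section \<open>Linearity, dimension and minimum distance of the evaluation code\<close>

lemma twisted_polys_add:
  assumes "P \<in> twisted_polys k \<eta>1 \<eta>2" "Q \<in> twisted_polys k \<eta>1 \<eta>2"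
  shows "P + Q \<in> twisted_polys k \<eta>1 \<eta>2"
  using assms by (auto simp: twisted_polys_def degree_add_le algebra_simps)

lemma twisted_polys_smult:
  assumes "P \<in> twisted_polys k \<eta>1 \<eta>2"
  shows "smult u P \<in> twisted_polys k \<eta>1 \<eta>2"
  using assms by (auto simp: twisted_polys_def algebra_simps)

lemma ev_add: "ev \<alpha> v (P + Q) = ev \<alpha> v P + ev \<alpha> v Q"
  by (simp add: ev_def vec_eq_iff algebra_simps)

lemma ev_smult: "ev \<alpha> v (smult u P) = u *s ev \<alpha> v P"
  by (simp add: ev_def vec_eq_iff algebra_simps)

lemma ev_0: "ev \<alpha> v 0 = 0"
  by (simp add: ev_def vec_eq_iff)

lemma ev_sum: "ev \<alpha> v (\<Sum>i\<in>I. P i) = (\<Sum>i\<in>I. ev \<alpha> v (P i))"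
  by (induction I rule: infinite_finite_induct) (simp_all add: ev_0 ev_add)

lemma ev_eq_iff:
  fixes \<alpha> v :: "'a::field ^ 'n"
  assumes "inj (($) \<alpha>)" "\<And>i. v $ i \<noteq> 0" "degree P < CARD('n)" "degree Q < CARD('n)"
  shows "ev \<alpha> v P = ev \<alpha> v Q \<longleftrightarrow> P = Q"
proof
  assume "ev \<alpha> v P = ev \<alpha> v Q"
  hence "poly P x = poly Q x" if "x \<in> range (($) \<alpha>)" for x
    using that assms(2) by (auto simp: ev_def vec_eq_iff)
  thus "P = Q"
    by (rule poly_eqI_degree) (use assms card_image[OF assms(1)] in auto)
qed simp

lemma subspace_ev_twisted_polys: "vec.subspace (ev \<alpha> v ` twisted_polys k \<eta>1 \<eta>2)"
proof (rule vec.subspaceI)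
  have "0 \<in> twisted_polys k \<eta>1 \<eta>2"
    by (simp add: twisted_polys_def)
  thus "0 \<in> ev \<alpha> v ` twisted_polys k \<eta>1 \<eta>2"
    using ev_0 by (metis imageI)
qed (auto simp flip: ev_add ev_smult intro!: imageI twisted_polys_add twisted_polys_smult)

text \<open>The words of the monomials below \<open>k\<close>, each corrected by its twist term,
  form a basis. The bound \<open>k + 1 < CARD('n)\<close> keeps evaluation injective on twisted
  polynomials.\<close>

lemma dim_ev_twisted_polys:
  fixes \<alpha> v :: "'a::field ^ 'n"
  assumes "inj (($) \<alpha>)" "\<And>i. v $ i \<noteq> 0" "k \<ge> 2" "k + 1 < CARD('n)"
  shows "vec.dim (ev \<alpha> v ` twisted_polys k \<eta>1 \<eta>2) = k"
proof -
  define w where "w i = (if i = k - 2 then \<eta>1 else if i = k - 1 then \<eta>2 else 0)" for i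
  define e where "e i = monom 1 i + monom (w i) (k + 1)" for i
  define T where "T = twisted_polys k \<eta>1 \<eta>2"
  have coeff_e: "coeff (e i) m = (if m = i then 1 else if m = k + 1 then w i else 0)"
    if "i < k" for i m
    using that by (auto simp: e_def)
  have e: "e i \<in> T" if "i < k" for i
  proof -
    have "degree (e i) \<le> k + 1"
      by (rule degree_le) (use that in \<open>auto simp: coeff_e\<close>)
    thus ?thesis
      using that assms(3) by (auto simp: T_def twisted_polys_def coeff_e w_def)
  qed
  have deg: "degree P < CARD('n)" if "P \<in> T" for P
    using that assms(4) by (auto simp: T_def twisted_polys_def)
  \<comment> \<open>The scalars of a combination of the \<open>e i\<close> are its coefficients
    below \<open>k\<close>; spanning and independence both rest on this.\<close>
  have coeff_sum_e: "coeff (\<Sum>i<k. smult (u i) (e i)) m = u m" if "m < k" for u m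
  proof -
    have "coeff (\<Sum>i<k. smult (u i) (e i)) m = (\<Sum>i<k. if i = m then u i else 0)"
      unfolding coeff_sum using that by (intro sum.cong) (auto simp: coeff_e)
    thus ?thesis
      using that by simp
  qed
  have sum_T: "(\<Sum>i\<in>I. smult (u i) (e i)) \<in> T" if "I \<subseteq> {..<k}" for u I
    using finite_subset[OF that finite_lessThan] that
  proof (induction I rule: finite_induct)
    case empty
    show ?case
      by (simp add: T_def twisted_polys_def)
  next
    case (insert i I)
    thus ?case
      using e by (auto simp: T_def intro!: twisted_polys_add twisted_polys_smult)
  qed
  have inj_e: "inj_on e {..<k}"
    by (rule inj_onI) (metis coeff_e lessThan_iff less_irrefl_nat trans_less_add1 zero_neq_one)
  have inj: "inj_on (\<lambda>i. ev \<alpha> v (e i)) {..<k}"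
    using inj_e ev_eq_iff[OF assms(1,2) deg deg] e by (auto simp: inj_on_def)
  show ?thesis
  proof (rule vec.dim_unique)
    show "(\<lambda>i. ev \<alpha> v (e i)) ` {..<k} \<subseteq> ev \<alpha> v ` twisted_polys k \<eta>1 \<eta>2"
      using e by (auto simp: T_def)
    show "ev \<alpha> v ` twisted_polys k \<eta>1 \<eta>2 \<subseteq> vec.span ((\<lambda>i. ev \<alpha> v (e i)) ` {..<k})"
    proof safe
      fix P assume P: "P \<in> twisted_polys k \<eta>1 \<eta>2"
      define Q where "Q = (\<Sum>i<k. smult (coeff P i) (e i))"
      have Q: "Q \<in> twisted_polys k \<eta>1 \<eta>2"
        using sum_T[of "{..<k}"] by (simp add: Q_def T_def)
      have low: "coeff Q m = coeff P m" if "m < k" for m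
        using that by (simp add: Q_def coeff_sum_e)
      \<comment> \<open>The coefficients below \<open>k\<close> determine a twisted polynomial: the
        one at \<open>k\<close> is 0 and the one at \<open>k + 1\<close> is fixed by the twist
        relation.\<close>
      have "coeff P m = coeff Q m" for m
      proof -
        consider "m < k" | "m = k" | "m = k + 1" | "m > k + 1"
          by linarith
        thus ?thesis
          by cases (use P Q low assms(3) in \<open>auto simp: twisted_polys_def coeff_eq_0\<close>)
      qed
      hence "P = Q"
        by (rule poly_eqI)
      hence "ev \<alpha> v P = ev \<alpha> v Q"
        by simp
      also have "\<dots> = (\<Sum>i<k. coeff P i *s ev \<alpha> v (e i))"
        by (simp add: Q_def ev_sum ev_smult)
      also have "\<dots> \<in> vec.span ((\<lambda>i. ev \<alpha> v (e i)) ` {..<k})"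
        by (intro vec.span_sum vec.span_scale vec.span_base) auto
      finally show "ev \<alpha> v P \<in> vec.span ((\<lambda>i. ev \<alpha> v (e i)) ` {..<k})" .
    qed
    show "vec.independent ((\<lambda>i. ev \<alpha> v (e i)) ` {..<k})"
    proof (rule vec.independent_if_scalars_zero)
      fix u x
      assume sum0: "(\<Sum>x\<in>(\<lambda>i. ev \<alpha> v (e i)) ` {..<k}. u x *s x) = 0"
        and "x \<in> (\<lambda>i. ev \<alpha> v (e i)) ` {..<k}"
      then obtain j where j: "j < k" "x = ev \<alpha> v (e j)"
        by auto
      \<comment> \<open>The scalars \<open>u\<close> are indexed by words; injectivity of the map
        from indices to words turns the sum into one over indices.\<close>
      let ?Q = "\<Sum>i<k. smult (u (ev \<alpha> v (e i))) (e i)"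
      have "ev \<alpha> v ?Q = ev \<alpha> v 0"
        using sum0 by (simp add: sum.reindex[OF inj] ev_sum ev_smult ev_0)
      hence "?Q = 0"
        using sum_T[of "{..<k}"] deg assms(4) by (subst (asm) ev_eq_iff[OF assms(1,2)]) auto
      thus "u x = 0"
        using coeff_sum_e[OF j(1), of "\<lambda>i. u (ev \<alpha> v (e i))"] j(2) by simp
    qed simp
    show "card ((\<lambda>i. ev \<alpha> v (e i)) ` {..<k}) = k"
      using card_image[OF inj] by simp
  qed
qed

text \<open>Two words agree only at positions whose evaluation points are roots of
  \<open>P - Q\<close>, of which there are at most \<open>k + 1\<close>.\<close>

lemma min_distance_ev_twisted_polys:
  fixes \<alpha> v :: "'a::field ^ 'n"
  assumes "inj (($) \<alpha>)" "\<And>i. v $ i \<noteq> 0" "k \<ge> 2"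
  shows "CARD('n) - (k + 1) \<le> min_distance (ev \<alpha> v ` twisted_polys k \<eta>1 \<eta>2)"
    (is "_ \<le> min_distance (_ ` ?T)")
proof -
  have "CARD('n) - (k + 1) \<le> hamming_dist (ev \<alpha> v P) (ev \<alpha> v Q)"
    if "P \<in> ?T" "Q \<in> ?T" "P \<noteq> Q" for P Q
  proof -
    have "card {i. ev \<alpha> v P $ i = ev \<alpha> v Q $ i} = card (($) \<alpha> ` {i. ev \<alpha> v P $ i = ev \<alpha> v Q $ i})"
      by (rule card_image[OF inj_on_subset[OF assms(1) subset_UNIV], symmetric])
    also have "\<dots> \<le> card {x. poly (P - Q) x = 0}"
    proof (rule card_mono)
      show "finite {x. poly (P - Q) x = 0}"
        by (rule poly_roots_finite) (use that in simp)
    qed (use assms(2) in \<open>auto simp: ev_def\<close>)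
    also have "\<dots> \<le> degree (P - Q)"
      using that by (intro card_poly_roots_bound) auto
    also have "\<dots> \<le> k + 1"
      using that by (intro degree_diff_le) (auto simp: twisted_polys_def)
    finally have "card {i. ev \<alpha> v P $ i = ev \<alpha> v Q $ i} \<le> k + 1" .
    moreover have "hamming_dist (ev \<alpha> v P) (ev \<alpha> v Q)
        = CARD('n) - card {i. ev \<alpha> v P $ i = ev \<alpha> v Q $ i}"
      by (simp add: hamming_dist_def Collect_neg_eq Compl_eq_Diff_UNIV card_Diff_subset)
    ultimately show ?thesis
      by simp
  qed
  note bound = this
  \<comment> \<open>If \<open>k + 1\<close> reaches the length, truncated subtraction makes the
    bound 0. Otherwise the positive dimension supplies a nonzero word, so the infimum is over a
    nonempty set.\<close>
  show ?thesis
  proof (cases "k + 1 < CARD('n)")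
    case True
    hence "\<not> ev \<alpha> v ` ?T \<subseteq> {0}"
      using dim_ev_twisted_polys[OF assms True, of \<eta>1 \<eta>2] assms(3)
        vec.dim_eq_0[of "ev \<alpha> v ` ?T"] by linarith
    then obtain x where x: "x \<in> ev \<alpha> v ` ?T" "x \<noteq> 0"
      by blast
    have "0 \<in> ev \<alpha> v ` ?T"
      using subspace_ev_twisted_polys by (rule vec.subspace_0)
    with x have "\<exists>x y. x \<in> ev \<alpha> v ` ?T \<and> y \<in> ev \<alpha> v ` ?T \<and> x \<noteq> y"
      by (intro exI[of _ x] exI[of _ 0] conjI)
    thus ?thesis
      unfolding min_distance_def
    proof (intro cInf_greatest)
      fix d assume "d \<in> {hamming_dist x y |x y. x \<in> ev \<alpha> v ` ?T \<and> y \<in> ev \<alpha> v ` ?T \<and> x \<noteq> y}"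
      then obtain P Q where "d = hamming_dist (ev \<alpha> v P) (ev \<alpha> v Q)" "P \<in> ?T" "Q \<in> ?T"
        "ev \<alpha> v P \<noteq> ev \<alpha> v Q"
        by force
      thus "CARD('n) - (k + 1) \<le> d"
        using bound[of P Q] by fastforce
    qed simp
  qed simp
qed

section \<open>The Euclidean inner product and self-duality\<close>

lemma sum_ev_mult_ev:
  fixes \<alpha> v :: "'a::field ^ 'n"
  assumes "inj (($) \<alpha>)" "\<And>i. (v $ i)\<^sup>2 = inverse (poly (pderiv g) (\<alpha> $ i))"
  shows "(\<Sum>i\<in>UNIV. ev \<alpha> v P $ i * ev \<alpha> v Q $ i)
       = (\<Sum>x\<in>range (($) \<alpha>). poly (P * Q) x / poly (pderiv g) x)"
proof -
  have "ev \<alpha> v P $ i * ev \<alpha> v Q $ i = poly (P * Q) (\<alpha> $ i) / poly (pderiv g) (\<alpha> $ i)" for i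
    unfolding divide_inverse assms(2)[symmetric] by (simp add: ev_def power2_eq_square)
  thus ?thesis
    by (simp add: sum.reindex[OF assms(1)] o_def)
qed

text \<open>With L(P) standing for \<open>coeff P (k - 2) - a * coeff P (k - 1)\<close>, the twist
  relation reads \<open>coeff P (k + 1) = \<eta>1 * L(P)\<close>. The choice of
  \<open>\<eta>1\<close> makes the term in \<open>coeff P (k + 1) * coeff Q (k + 1)\<close> equal to
  \<open>2 * L(Q) * coeff P (k + 1)\<close>, which balances the two mixed terms when both
  polynomials are twisted.\<close>

lemma self_dual_ev_twisted_polys:
  fixes \<alpha> v :: "'a::field ^ 'n" and a b c :: 'a
  assumes inj: "inj (($) \<alpha>)"
    and g: "g = (\<Prod>x\<in>range (($) \<alpha>). [:- x, 1:])"
    and g': "g = monom 1 (2 * k) + monom a (2 * k - 1) + monom b (2 * k - 2) + [:c:]"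
    and v: "\<And>i. (v $ i)\<^sup>2 = inverse (poly (pderiv g) (\<alpha> $ i))"
    and k: "CARD('n) = 2 * k" "k \<ge> 2" and "a \<noteq> 0" "a\<^sup>2 \<noteq> 2 * b"
    and \<eta>: "\<eta>1 = 2 * inverse a * inverse (a\<^sup>2 - 2 * b)" "\<eta>2 = - a * \<eta>1"
  shows "self_dual (ev \<alpha> v ` twisted_polys k \<eta>1 \<eta>2)"
proof -
  let ?A = "range (($) \<alpha>)"
  define T where "T = twisted_polys k \<eta>1 \<eta>2"
  have card: "card ?A = 2 * k"
    using k inj by (simp add: card_image)
  have v0: "v $ i \<noteq> 0" for i
    using poly_pderiv_prod_linear_nonzero[of ?A "\<alpha> $ i"] v[of i] g by auto
  have "a * (a\<^sup>2 - 2 * b) * \<eta>1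
      = 2 * (a * inverse a) * ((a\<^sup>2 - 2 * b) * inverse (a\<^sup>2 - 2 * b))"
    unfolding \<eta>(1) by (simp only: mult_ac)
  hence \<eta>1: "a * (a\<^sup>2 - 2 * b) * \<eta>1 = 2"
    using \<open>a \<noteq> 0\<close> \<open>a\<^sup>2 \<noteq> 2 * b\<close> by simp
  have T: "degree Q \<le> k + 1" "coeff Q k = 0"
    "coeff Q (k + 1) = \<eta>1 * (coeff Q (k - 2) - a * coeff Q (k - 1))" if "Q \<in> T" for Q
    using that by (auto simp: T_def twisted_polys_def \<eta>(2) algebra_simps)
  \<comment> \<open>Only \<open>Q\<close> is twisted here, so the formula serves both inclusions:
    its two summands measure how far \<open>P\<close> is from satisfying the two coefficient
    conditions.\<close>
  have form: "(\<Sum>i\<in>UNIV. ev \<alpha> v P $ i * ev \<alpha> v Q $ i) =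
      coeff P k * (coeff Q (k - 1) + (a\<^sup>2 - b) * coeff Q (k + 1))
      + (coeff Q (k - 2) - a * coeff Q (k - 1))
        * (\<eta>1 * (coeff P (k - 2) - a * coeff P (k - 1)) - coeff P (k + 1))"
    if "degree P \<le> k + 1" "Q \<in> T" for P Q
  proof -
    have "a * (a\<^sup>2 - 2 * b) * coeff P (k + 1) * coeff Q (k + 1)
        = a * (a\<^sup>2 - 2 * b) * \<eta>1 * (coeff Q (k - 2) - a * coeff Q (k - 1)) * coeff P (k + 1)"
      unfolding T(3)[OF that(2)] by (simp only: mult_ac)
    also have "\<dots> = 2 * (coeff Q (k - 2) - a * coeff Q (k - 1)) * coeff P (k + 1)"
      by (simp only: \<eta>1)
    finally have *: "a * (a\<^sup>2 - 2 * b) * coeff P (k + 1) * coeff Q (k + 1)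
        = 2 * (coeff Q (k - 2) - a * coeff Q (k - 1)) * coeff P (k + 1)" .
    show ?thesis
      unfolding sum_ev_mult_ev[OF inj v]
        sum_div_pderiv_mult[OF g g' card k(2) that(1) T(1,2)[OF that(2)]] *
      unfolding T(3)[OF that(2)] by (simp only: algebra_simps mult_2)
  qed
  have "(\<Sum>i\<in>UNIV. ev \<alpha> v P $ i * ev \<alpha> v Q $ i) = 0" if "P \<in> T" "Q \<in> T" for P Q
    using form[of P Q] T[OF that(1)] that(2) by simp
  hence "ev \<alpha> v ` T \<subseteq> dual_code (ev \<alpha> v ` T)"
    by (auto simp: dual_code_def)
  moreover have "dual_code (ev \<alpha> v ` T) \<subseteq> ev \<alpha> v ` T"
  proof
    fix y assume y: "y \<in> dual_code (ev \<alpha> v ` T)"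
    \<comment> \<open>Dividing by the entries of \<open>v\<close> undoes the scaling, so that
      \<open>y\<close> becomes the word of \<open>F\<close>.\<close>
    obtain F where F: "degree F < card ?A" "\<And>x. x \<in> ?A \<Longrightarrow>
        poly F x = y $ (inv (($) \<alpha>) x) / v $ (inv (($) \<alpha>) x)"
      using exists_interpolating_poly[of ?A "\<lambda>x. y $ (inv (($) \<alpha>) x) / v $ (inv (($) \<alpha>) x)"]
      by auto
    have yF: "y = ev \<alpha> v F"
      using F(2) v0 inj by (simp add: ev_def vec_eq_iff)
    have orth: "(\<Sum>i\<in>UNIV. ev \<alpha> v F $ i * ev \<alpha> v Q $ i) = 0" if "Q \<in> T" for Q
      using y that by (auto simp: dual_code_def yF mult.commute)
    \<comment> \<open>For \<open>i < k - 2\<close> the monomial of degree \<open>i\<close> avoids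
      all coefficients in the twist relation, so it lies in \<open>T\<close>. Orthogonality to it
      kills the coefficient of \<open>F\<close> at \<open>2 * k - 1 - i\<close>, lowering the degree
      bound by one each time.\<close>
    have "i \<le> k - 2 \<Longrightarrow> degree F < 2 * k - i" for i
    proof (induction i)
      case 0
      thus ?case
        using F(1) card by simp
    next
      case (Suc i)
      have "monom 1 i \<in> T"
        using Suc.prems by (auto simp: T_def twisted_polys_def degree_monom_eq)
      moreover have "degree (F * monom 1 i) < card ?A"
        using Suc card degree_mult_le[of F "monom 1 i"] by (simp add: degree_monom_eq)
      ultimately have "coeff (F * monom 1 i) (2 * k - 1) = 0"
        using orth sum_div_pderiv_eq_coeff[of ?A "F * monom 1 i"] card
        unfolding sum_ev_mult_ev[OF inj v] g by simp
      hence "coeff F (2 * k - 1 - i) = 0"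
        using Suc.prems by (simp add: mult.commute[of F] coeff_monom_mult split: if_splits)
      moreover have "degree F \<le> 2 * k - 1 - i"
        using Suc by simp
      ultimately have "degree F < 2 * k - 1 - i"
        using Suc.prems eq_zero_or_degree_less[of F "2 * k - 1 - i"] by auto
      thus ?case
        by simp
    qed
    from this[of "k - 2"] have degF: "degree F \<le> k + 1"
      using k by simp
    \<comment> \<open>Chosen with L(Q) = 0: it needs no twist term, and \<open>form\<close> reduces
      to \<open>coeff F k\<close>.\<close>
    let ?Q = "monom a (k - 2) + monom 1 (k - 1)"
    have Q: "coeff ?Q (k - 2) = a" "coeff ?Q (k - 1) = 1" "coeff ?Q k = 0" "coeff ?Q (k + 1) = 0"
      using k by auto
    moreover have "degree ?Q \<le> k + 1"
      by (rule degree_le) auto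
    ultimately have "?Q \<in> T"
      by (simp add: T_def twisted_polys_def \<eta>(2))
    from form[OF degF this] orth[OF this] have Fk: "coeff F k = 0"
      unfolding Q by simp
    \<comment> \<open>Here L(R) = 1, so once \<open>coeff F k = 0\<close> is known,
      \<open>form\<close> leaves exactly the defect of \<open>F\<close> in the twist
      relation.\<close>
    let ?R = "monom 1 (k - 2) + monom \<eta>1 (k + 1)"
    have R: "coeff ?R (k - 2) = 1" "coeff ?R (k - 1) = 0" "coeff ?R k = 0" "coeff ?R (k + 1) = \<eta>1"
      using k by auto
    moreover have "degree ?R \<le> k + 1"
      by (rule degree_le) auto
    ultimately have "?R \<in> T"
      by (simp add: T_def twisted_polys_def)
    from form[OF degF this] orth[OF this]
    have "coeff F (k + 1) = \<eta>1 * (coeff F (k - 2) - a * coeff F (k - 1))"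
      unfolding R Fk by simp
    hence "F \<in> T"
      using degF Fk by (simp add: T_def twisted_polys_def \<eta>(2) algebra_simps)
    thus "y \<in> ev \<alpha> v ` T"
      by (simp add: yF)
  qed
  ultimately show ?thesis
    by (auto simp: self_dual_def T_def)
qed

section \<open>The self-dual code attached to the quadrinomial\<close>

theorem theorem33:
  fixes p s h t r q k :: nat
    and Fpt Fq :: "'a::finite_field set"
    and a b c \<eta>1 \<eta>2 :: 'a
    and g :: "'a poly"
    and \<alpha> :: "'a ^ 'n"
    and S1 :: "'a poly set"
  assumes "prime p" "odd p"
    and "s > 0" "h > 0" "t > 0" "r > 0"
    and "t dvd h" "s \<le> h"
    and "q = p ^ h"
    and "CARD('a) = q ^ 2"
    and "is_subfield Fq" "card Fq = q"
    and "is_subfield Fpt" "card Fpt = p ^ t"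
    and "a \<in> Fpt" "b \<in> Fpt" "c \<in> Fpt"
    and "a \<noteq> 0" "b \<noteq> 0" "c \<noteq> 0"
    and "b \<noteq> 1 / 2 * a ^ 2"
    and "g = monom 1 (2 * r * p ^ s) + monom a (2 * r * p ^ s - 1)
               + monom b (2 * r * p ^ s - 2) + [:c:]"
    and "is_splitting_field Fpt Fq g"
    and "CARD('n) = 2 * r * p ^ s"
    and "range (($) \<alpha>) = {x. poly g x = 0}" "inj (($) \<alpha>)"
    and "k = r * p ^ s"
    and "\<eta>1 = 2 * inverse a * inverse (a ^ 2 - 2 * b)" "\<eta>2 = - a * \<eta>1"
    and "S1 = {(\<Sum>i=0..k - 1. monom (f i) i)
                 + monom (2 * inverse (a ^ 2 - 2 * b)
                            * (inverse a * f (k - 2) - f (k - 1))) (k + 1) |f. True}"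
  shows "(\<exists>v :: 'a ^ 'n. \<forall>i. (v $ i) ^ 2 = inverse (poly (pderiv g) (\<alpha> $ i))) \<and>
    (\<forall>v :: 'a ^ 'n. (\<forall>i. (v $ i) ^ 2 = inverse (poly (pderiv g) (\<alpha> $ i))) \<longrightarrow>
       is_linear_code (2 * r * p ^ s) k (k - 1) (ev \<alpha> v ` S1) \<and>
       self_dual (ev \<alpha> v ` S1) \<and>
       is_TGRS k (ev \<alpha> v ` S1) \<and>
       ev \<alpha> v ` S1 =
         tgrs_code k (\<lambda>i j. if i = k - 1 \<and> j = 2 then \<eta>1
                            else if i = k \<and> j = 2 then \<eta>2 else 0) \<alpha> v)"
proof -
  have n: "2 * r * p ^ s = 2 * k"
    by (simp add: \<open>k = r * p ^ s\<close>)
  have "p \<ge> 2"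
    using \<open>prime p\<close> by (rule prime_ge_2_nat)
  have "p ^ s \<ge> 2"
    using \<open>p \<ge> 2\<close> \<open>s > 0\<close> self_le_power[of p s] by linarith
  \<comment> \<open>\<open>p ^ s\<close> is odd; with \<open>p ^ s \<ge> 2\<close> this gives
    \<open>k \<ge> 3\<close>.\<close>
  moreover have "p ^ s \<noteq> 2"
    using \<open>odd p\<close> by (metis even_power dvd_refl)
  moreover have "k \<ge> p ^ s"
    using \<open>r > 0\<close> by (simp add: \<open>k = r * p ^ s\<close>)
  ultimately have k: "k \<ge> 3"
    by linarith
  have card: "CARD('n) = 2 * k"
    unfolding n[symmetric] by fact
  have g: "g = monom 1 (2 * k) + monom a (2 * k - 1) + monom b (2 * k - 2) + [:c:]"
    unfolding n[symmetric] by fact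
  have D: "a\<^sup>2 \<noteq> 2 * b"
  proof
    assume "a\<^sup>2 = 2 * b"
    \<comment> \<open>The assumed equation itself excludes characteristic 2, since there it would
      give \<open>a = 0\<close>; division by 2 is then legitimate.\<close>
    moreover from this have "(2::'a) \<noteq> 0"
      using \<open>a \<noteq> 0\<close> by auto
    ultimately show False
      using \<open>b \<noteq> 1 / 2 * a ^ 2\<close> by simp
  qed
  have coeff_g: "coeff g (2 * k) = 1"
    using k by (auto simp: g coeff_pCons split: nat.splits)
  have deg_g: "degree g = 2 * k"
  proof (rule antisym)
    show "degree g \<le> 2 * k"
      by (rule degree_le) (auto simp: g coeff_pCons split: nat.splits)
    show "2 * k \<le> degree g"
      by (rule le_degree) (simp add: coeff_g)
  qed
  have prod: "g = (\<Prod>x\<in>range (($) \<alpha>). [:- x, 1:])"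
  \<comment> \<open>The \<open>2 * k\<close> distinct coordinates of \<open>\<alpha>\<close> exhaust
    the degree of \<open>g\<close>, so all its roots are simple.\<close>
  proof (rule monic_poly_eq_prod_roots)
    show "card (range (($) \<alpha>)) = degree g"
      by (simp add: card_image \<open>inj (($) \<alpha>)\<close> card deg_g)
  qed (use k coeff_g deg_g \<open>range (($) \<alpha>) = {x. poly g x = 0}\<close> in auto)
  have nz: "poly (pderiv g) (\<alpha> $ i) \<noteq> 0" for i
    unfolding prod by (rule poly_pderiv_prod_linear_nonzero) auto
  have S1: "S1 = twisted_polys k \<eta>1 \<eta>2"
  proof -
    have "{0..k - 1} = {..<k}"
      using k by auto
    \<comment> \<open>Factoring out \<open>inverse a\<close> gives
      \<open>\<eta>1 * (u - a * w)\<close>, and \<open>\<eta>2 = - a * \<eta>1\<close>.\<close>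
    moreover have "2 * inverse (a\<^sup>2 - 2 * b) * (inverse a * u - w) = \<eta>1 * u + \<eta>2 * w" for u w
      using \<open>a \<noteq> 0\<close> by (simp add: \<open>\<eta>1 = _\<close> \<open>\<eta>2 = _\<close> algebra_simps)
    ultimately show ?thesis
      using k by (simp add: \<open>S1 = _\<close> twisted_polys_eq)
  qed
  have tgrs: "ev \<alpha> v ` S1 = tgrs_code k (\<lambda>i j. if i = k - 1 \<and> j = 2 then \<eta>1
      else if i = k \<and> j = 2 then \<eta>2 else 0) \<alpha> v" for v
    using k by (simp only: tgrs_code_def S1 card tgrs_polys_eq_twisted_polys)
  have "\<exists>x. x\<^sup>2 = inverse (poly (pderiv g) (\<alpha> $ i))" for i
  proof -
    have "poly g (\<alpha> $ i) = 0"
      using \<open>range (($) \<alpha>) = {x. poly g x = 0}\<close> by auto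
    moreover have "g \<noteq> 0"
      using coeff_g by auto
    ultimately have "\<alpha> $ i \<in> Fq"
      by (intro splitting_field_contains_roots[OF \<open>is_splitting_field Fpt Fq g\<close>])
    moreover have "coeff g m \<in> Fq" for m
      using \<open>is_splitting_field Fpt Fq g\<close> by (auto simp: is_splitting_field_def)
    ultimately have "poly (pderiv g) (\<alpha> $ i) \<in> Fq"
      using \<open>is_subfield Fq\<close> by (intro poly_in_subfield coeff_pderiv_in_subfield)
    hence "inverse (poly (pderiv g) (\<alpha> $ i)) \<in> Fq"
      using \<open>is_subfield Fq\<close> by (simp add: is_subfield_def)
    moreover have "odd (card Fq)" "CARD('a) = card Fq ^ 2"
      using \<open>odd p\<close> \<open>q = p ^ h\<close> \<open>card Fq = q\<close> \<open>CARD('a) = q ^ 2\<close> by simp_all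
    ultimately show ?thesis
      using subfield_has_sqrt_in_quadratic_extension[OF \<open>is_subfield Fq\<close>] by metis
  qed
  then obtain w where w: "\<And>i. (w i)\<^sup>2 = inverse (poly (pderiv g) (\<alpha> $ i))"
    by metis
  show ?thesis
  proof (intro conjI allI impI)
    show "\<exists>v :: 'a ^ 'n. \<forall>i. (v $ i) ^ 2 = inverse (poly (pderiv g) (\<alpha> $ i))"
      using w by (intro exI[of _ "\<chi> i. w i"]) simp
  next
    fix v :: "'a ^ 'n"
    assume v: "\<forall>i. (v $ i) ^ 2 = inverse (poly (pderiv g) (\<alpha> $ i))"
    have v0: "v $ i \<noteq> 0" for i
      using spec[OF v, of i] nz[of i] by auto
    note inj = \<open>inj (($) \<alpha>)\<close>
    \<comment> \<open>The distance bound is \<open>2 * k - (k + 1) = k - 1\<close>.\<close>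
    show "is_linear_code (2 * r * p ^ s) k (k - 1) (ev \<alpha> v ` S1)"
      using subspace_ev_twisted_polys[of \<alpha> v k \<eta>1 \<eta>2]
        dim_ev_twisted_polys[OF inj v0, of k \<eta>1 \<eta>2]
        min_distance_ev_twisted_polys[OF inj v0, of k \<eta>1 \<eta>2] k card
      by (simp add: is_linear_code_def S1 n)
    show "self_dual (ev \<alpha> v ` S1)"
      unfolding S1
      by (rule self_dual_ev_twisted_polys[OF inj prod g _ card])
        (use v k D \<open>a \<noteq> 0\<close> \<open>\<eta>1 = _\<close> \<open>\<eta>2 = _\<close> in auto)
    show "is_TGRS k (ev \<alpha> v ` S1)"
      unfolding is_TGRS_def using card inj v0 tgrs by (intro conjI exI) auto
    show "ev \<alpha> v ` S1 = tgrs_code k (\<lambda>i j. if i = k - 1 \<and> j = 2 then \<eta>1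
        else if i = k \<and> j = 2 then \<eta>2 else 0) \<alpha> v"
      by (rule tgrs)
  qed
qed

end
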